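(* Let $u(x,t)$ be the solution of the time-space fractional convection-diffusion problem below, and $\{u^j_i\}$ the solution of the implicit difference scheme below, with $N\ge5$ and $d_+(t)+d_-(t)\ge d_*>0$ on $[0,T]$. Assume $u$ is smooth enough (e.g. $u\in\mathcal C^{4,3}_{x,t}$ with the regularity required for the consistency estimates) that the local truncation error $R^{j+\sigma}_i:=\Delta^\alpha_{0,t_{j+\sigma}}u(x_i,\cdot)-(\delta^{\beta,(j)}_h u^{(\sigma)}_{\mathrm{ex}})_i-f^{j+\sigma}_i$, where $u^{(\sigma)}_{\mathrm{ex},i}=\sigma u(x_i,t_{j+1})+(1-\sigma)u(x_i,t_j)$, satisfies $|R^{j+\sigma}_i|\le C_R(\tau^2+h^2)$ for all $i,j$, with $C_R$ independent of $h,\tau$. Let $E^j_i=u(x_i,t_j)-u^j_i$. Then there is a constant $\tilde c>0$ independent of $h$ and $\tau$ such that \[ \|E^j\|\le \tilde c(\tau^2+h^2),\qquad 0\le j\le M. \]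
   Context: The continuous problem: for $0<\alpha<1$, $1<\beta<2$, $a<x<b$, $0<t\le T$, $\partial^\alpha_{0,t}u=\gamma(t)\partial_xu+d_+(t)\,{}_aD^\beta_xu+d_-(t)\,{}_xD^\beta_bu+f(x,t)$, $u(x,0)=\phi(x)$, $u(a,t)=u(b,t)=0$, where $\partial^\alpha_{0,t}u=\frac{1}{\Gamma(1-\alpha)}\int_0^t\partial_\xi u(x,\xi)(t-\xi)^{-\alpha}d\xi$ (Caputo), ${}_aD^\beta_xu=\frac{1}{\Gamma(2-\beta)}\partial_x^2\int_a^x u(\eta,t)(x-\eta)^{1-\beta}d\eta$, ${}_xD^\beta_bu=\frac{1}{\Gamma(2-\beta)}\partial_x^2\int_x^b u(\eta,t)(\eta-x)^{1-\beta}d\eta$ (Riemann–Liouville); $\gamma$ real, $d_\pm\ge0$. Grids: $h=(b-a)/N$, $x_i=a+ih$, $\tau=T/M$, $t_j=j\tau$, $\sigma=1-\alpha/2$, $t_{j+\sigma}=(j+\sigma)\tau$. $\|\bm v\|^2=h\sum_{i=1}^{N-1}v_i^2$. Time discretization: $a_0=\sigma^{1-\alpha}$, $a_\ell=(\ell+\sigma)^{1-\alpha}-(\ell-1+\sigma)^{1-\alpha}$ ($\ell\ge1$), $b_\ell=\frac{1}{2-\alpha}[(\ell+\sigma)^{2-\alpha}-(\ell-1+\sigma)^{2-\alpha}]-\frac12[(\ell+\sigma)^{1-\alpha}+(\ell-1+\sigma)^{1-\alpha}]$; $c^{(0)}_0=a_0$; for $j\ge1$: $c^{(j)}_0=a_0+b_1$,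 $c^{(j)}_m=a_m+b_{m+1}-b_m$ ($1\le m\le j-1$), $c^{(j)}_j=a_j-b_j$; $\Delta^\alpha_{0,t_{j+\sigma}}u=\frac{\tau^{-\alpha}}{\Gamma(2-\alpha)}\sum_{s=0}^jc^{(j)}_{j-s}(u^{s+1}-u^s)$. Space discretization: $g_k=(-1)^k\binom{\beta}{k}$, $\lambda_1=\frac{\beta^2+3\beta+2}{12}$, $\lambda_0=\frac{4-\beta^2}{6}$, $\lambda_{-1}=\frac{\beta^2-3\beta+2}{12}$, $\omega_0=\lambda_1g_0$, $\omega_1=\lambda_1g_1+\lambda_0g_0$, $\omega_k=\lambda_1g_k+\lambda_0g_{k-1}+\lambda_{-1}g_{k-2}$ ($k\ge2$); for a grid function $\bm v$ with $v_0=v_N=0$: $(\delta^{\beta,(j)}_h\bm v)_i=\gamma(t_{j+\sigma})\frac{v_{i+1}-v_{i-1}}{2h}+\frac{d_+(t_{j+\sigma})}{h^\beta}\sum_{k=0}^{i+1}\omega_kv_{i-k+1}+\frac{d_-(t_{j+\sigma})}{h^\beta}\sum_{k=0}^{N-i+1}\omega_kv_{i+k-1}$. Scheme: $\Delta^\alpha_{0,t_{j+\sigma}}u_i=(\delta^{\beta,(j)}_hu^{(\sigma)})_i+f(x_i,t_{j+\sigma})$ ($1\le i\le N-1$, $0\le j\le M-1$), $u^{(\sigma)}_i=\sigma u^{j+1}_i+(1-\sigma)u^j_i$, $u^0_i=\phi(x_i)$, $u^j_0=u^j_N=0$. *)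

theory Defs
  imports "HOL-Analysis.Analysis"
begin

definition caputo_t :: "real \<Rightarrow> (real \<Rightarrow> real \<Rightarrow> real) \<Rightarrow> real \<Rightarrow> real \<Rightarrow> real" where
  "caputo_t \<alpha> u x t = 1 / Gamma (1 - \<alpha>) *
     (LINT \<xi>:{0..t}|lborel. deriv (\<lambda>s. u x s) \<xi> * (t - \<xi>) powr (- \<alpha>))"

definition rl_left :: "real \<Rightarrow> real \<Rightarrow> (real \<Rightarrow> real \<Rightarrow> real) \<Rightarrow> real \<Rightarrow> real \<Rightarrow> real" where
  "rl_left \<beta> a u x t = 1 / Gamma (2 - \<beta>) *
     deriv (deriv (\<lambda>y. LINT \<eta>:{a..y}|lborel. u \<eta> t * (y - \<eta>) powr (1 - \<beta>))) x"

definition rl_right :: "real \<Rightarrow> real \<Rightarrow> (real \<Rightarrow> real \<Rightarrow> real) \<Rightarrow> real \<Rightarrow> real \<Rightarrow> real" where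
  "rl_right \<beta> b u x t = 1 / Gamma (2 - \<beta>) *
     deriv (deriv (\<lambda>y. LINT \<eta>:{y..b}|lborel. u \<eta> t * (\<eta> - y) powr (1 - \<beta>))) x"

section \<open>L2-1sigma time discretization\<close>

definition sig :: "real \<Rightarrow> real" where "sig \<alpha> = 1 - \<alpha> / 2"

definition acoef :: "real \<Rightarrow> nat \<Rightarrow> real" where
  "acoef \<alpha> l = (if l = 0 then sig \<alpha> powr (1 - \<alpha>)
     else (real l + sig \<alpha>) powr (1 - \<alpha>) - (real l - 1 + sig \<alpha>) powr (1 - \<alpha>))"

definition bcoef :: "real \<Rightarrow> nat \<Rightarrow> real" where
  "bcoef \<alpha> l = 1 / (2 - \<alpha>) * ((real l + sig \<alpha>) powr (2 - \<alpha>) - (real l - 1 + sig \<alpha>) powr (2 - \<alpha>))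
     - 1 / 2 * ((real l + sig \<alpha>) powr (1 - \<alpha>) + (real l - 1 + sig \<alpha>) powr (1 - \<alpha>))"

definition ccoef :: "real \<Rightarrow> nat \<Rightarrow> nat \<Rightarrow> real" where
  "ccoef \<alpha> j m =
     (if j = 0 then acoef \<alpha> 0
      else if m = 0 then acoef \<alpha> 0 + bcoef \<alpha> 1
      else if m < j then acoef \<alpha> m + bcoef \<alpha> (m + 1) - bcoef \<alpha> m
      else acoef \<alpha> j - bcoef \<alpha> j)"

text \<open>Discrete Caputo derivative at t_{j+sigma}; w s is the value at time level s.\<close>
definition disc_caputo :: "real \<Rightarrow> real \<Rightarrow> nat \<Rightarrow> (nat \<Rightarrow> real) \<Rightarrow> real" where
  "disc_caputo \<alpha> \<tau> j w = \<tau> powr (- \<alpha>) / Gamma (2 - \<alpha>) *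
     (\<Sum>s = 0..j. ccoef \<alpha> j (j - s) * (w (s + 1) - w s))"

definition gcoef :: "real \<Rightarrow> nat \<Rightarrow> real" where
  "gcoef \<beta> k = (-1) ^ k * (\<beta> gchoose k)"

definition lam1 :: "real \<Rightarrow> real" where "lam1 \<beta> = (\<beta>^2 + 3 * \<beta> + 2) / 12"
definition lam0 :: "real \<Rightarrow> real" where "lam0 \<beta> = (4 - \<beta>^2) / 6"
definition lamm1 :: "real \<Rightarrow> real" where "lamm1 \<beta> = (\<beta>^2 - 3 * \<beta> + 2) / 12"

definition omega :: "real \<Rightarrow> nat \<Rightarrow> real" where
  "omega \<beta> k =
     (if k = 0 then lam1 \<beta> * gcoef \<beta> 0
      else if k = 1 then lam1 \<beta> * gcoef \<beta> 1 + lam0 \<beta> * gcoef \<beta> 0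
      else lam1 \<beta> * gcoef \<beta> k + lam0 \<beta> * gcoef \<beta> (k - 1) + lamm1 \<beta> * gcoef \<beta> (k - 2))"

text \<open>(delta_h^{beta,(j)} v)_i, where v is a grid function indexed 0..N and
  ts = t_{j+sigma} is the time at which the coefficients are evaluated.\<close>
definition delta_h :: "(real \<Rightarrow> real) \<Rightarrow> (real \<Rightarrow> real) \<Rightarrow> (real \<Rightarrow> real) \<Rightarrow> real \<Rightarrow> nat \<Rightarrow> real
    \<Rightarrow> real \<Rightarrow> (nat \<Rightarrow> real) \<Rightarrow> nat \<Rightarrow> real" where
  "delta_h \<gamma> dp dm \<beta> N h ts v i =
     \<gamma> ts * (v (i + 1) - v (i - 1)) / (2 * h)
     + dp ts / h powr \<beta> * (\<Sum>k = 0..i + 1. omega \<beta> k * v (i + 1 - k))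
     + dm ts / h powr \<beta> * (\<Sum>k = 0..N - i + 1. omega \<beta> k * v (i + k - 1))"

definition grid_norm :: "nat \<Rightarrow> real \<Rightarrow> (nat \<Rightarrow> real) \<Rightarrow> real" where
  "grid_norm N h v = sqrt (h * (\<Sum>i = 1..N - 1. (v i)^2))"

definition is_scheme_solution ::
  "real \<Rightarrow> real \<Rightarrow> real \<Rightarrow> real \<Rightarrow> real \<Rightarrow> (real \<Rightarrow> real) \<Rightarrow> (real \<Rightarrow> real) \<Rightarrow> (real \<Rightarrow> real)
   \<Rightarrow> (real \<Rightarrow> real \<Rightarrow> real) \<Rightarrow> (real \<Rightarrow> real) \<Rightarrow> nat \<Rightarrow> nat \<Rightarrow> (nat \<Rightarrow> nat \<Rightarrow> real) \<Rightarrow> bool" where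
  "is_scheme_solution \<alpha> \<beta> a b T \<gamma> dp dm f \<phi> N M U \<longleftrightarrow>
    (let h = (b - a) / real N; \<tau> = T / real M; \<sigma> = sig \<alpha> in
      (\<forall>i. 1 \<le> i \<and> i \<le> N - 1 \<longrightarrow> U 0 i = \<phi> (a + real i * h)) \<and>
      (\<forall>j \<le> M. U j 0 = 0 \<and> U j N = 0) \<and>
      (\<forall>i j. 1 \<le> i \<and> i \<le> N - 1 \<and> j < M \<longrightarrow>
          disc_caputo \<alpha> \<tau> j (\<lambda>s. U s i)
          = delta_h \<gamma> dp dm \<beta> N h ((real j + \<sigma>) * \<tau>)
              (\<lambda>k. \<sigma> * U (j + 1) k + (1 - \<sigma>) * U j k) i
            + f (a + real i * h) ((real j + \<sigma>) * \<tau>)))"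

definition trunc_err ::
  "real \<Rightarrow> real \<Rightarrow> real \<Rightarrow> real \<Rightarrow> real \<Rightarrow> (real \<Rightarrow> real) \<Rightarrow> (real \<Rightarrow> real) \<Rightarrow> (real \<Rightarrow> real)
   \<Rightarrow> (real \<Rightarrow> real \<Rightarrow> real) \<Rightarrow> (real \<Rightarrow> real \<Rightarrow> real) \<Rightarrow> nat \<Rightarrow> nat \<Rightarrow> nat \<Rightarrow> nat \<Rightarrow> real" where
  "trunc_err \<alpha> \<beta> a b T \<gamma> dp dm f u N M i j =
    (let h = (b - a) / real N; \<tau> = T / real M; \<sigma> = sig \<alpha> in
      disc_caputo \<alpha> \<tau> j (\<lambda>s. u (a + real i * h) (real s * \<tau>))
      - delta_h \<gamma> dp dm \<beta> N h ((real j + \<sigma>) * \<tau>)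
          (\<lambda>k. \<sigma> * u (a + real k * h) (real (j + 1) * \<tau>) + (1 - \<sigma>) * u (a + real k * h) (real j * \<tau>)) i
      - f (a + real i * h) ((real j + \<sigma>) * \<tau>))"

end

theory Submission
  imports Defs
begin

text \<open>
  The spatial operator is negative semidefinite for the discrete inner product: the convection term is
  antisymmetric, the right sum is the left sum of the reversed grid function, and the left sum is a
  Toeplitz form whose symmetrised off-diagonal weights \<open>\<omega>\<^sub>0 + \<omega>\<^sub>2, \<omega>\<^sub>3, \<omega>\<^sub>4, \<dots>\<close> are
  nonnegative while the partial sums of all weights are nonpositive. In time, the weights
  \<open>c\<^sub>m\<close> decrease in \<open>m\<close> and satisfy \<open>\<sigma>\<^sup>2 c\<^sub>1 \<le> (2 \<sigma> - 1) c\<^sub>0\<close>, which gives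
  Alikhanov's inequality \<open>\<Delta>\<^sup>\<alpha> (w\<^sup>2) \<le> 2 w\<^sup>(\<^sup>\<sigma>\<^sup>) \<Delta>\<^sup>\<alpha> w\<close>. Testing the error equation with
  \<open>E\<^sup>(\<^sup>\<sigma>\<^sup>)\<close> bounds \<open>\<Delta>\<^sup>\<alpha> \<parallel>E\<parallel>\<^sup>2\<close> by \<open>\<epsilon> Y + \<parallel>R\<parallel>\<^sup>2 / \<epsilon>\<close>, where
  \<open>Y\<close> is the maximum of \<open>\<parallel>E\<^sup>j\<parallel>\<^sup>2\<close> over all time levels; the discrete maximum principle then
  bounds \<open>Y\<close> by a constant multiple of the same quantity, and a small \<open>\<epsilon>\<close> absorbs \<open>Y\<close>.
\<close>

section \<open>Dissipativity of the spatial discretization\<close>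

lemma gcoef_Suc: "gcoef b (Suc k) = gcoef b k * ((real k - b) / (real k + 1))"
proof -
  have "real (Suc k) * (b gchoose Suc k) = (b - real k) * (b gchoose k)"
    using gbinomial_mult_1[of b k] by (simp add: algebra_simps)
  then have "b gchoose Suc k = (b - real k) * (b gchoose k) / (real k + 1)"
    by (simp add: field_simps)
  then show ?thesis
    unfolding gcoef_def by (simp only: power_Suc) (simp add: field_simps)
qed

lemma gcoef_0 [simp]: "gcoef b 0 = 1"
  by (simp add: gcoef_def)

text \<open>Taking partial sums divides the generating function (1 - z)^b by 1 - z, which lowers the
  order by one.\<close>

lemma sum_gcoef: "(\<Sum>k\<le>n. gcoef b k) = gcoef (b - 1) n"
  using gbinomial_sum_lower_neg[of b n] by (simp add: gcoef_def mult.commute)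

lemma gcoef_pos:
  assumes "1 < b" "b < 2"
  shows "gcoef b (k + 2) > 0"
proof (induction k)
  case 0
  then show ?case using assms
    by (simp add: gcoef_Suc numeral_2_eq_2 mult_less_0_iff)
next
  case (Suc k)
  have "gcoef b (Suc k + 2) = gcoef b (k + 2) * ((real (k + 2) - b) / (real (k + 2) + 1))"
    using gcoef_Suc[of b "k + 2"] by simp
  then show ?case using Suc assms by simp
qed

lemma gcoef_neg:
  assumes "0 < b" "b < 1"
  shows "gcoef b (Suc k) < 0"
proof (induction k)
  case 0
  then show ?case using assms by (simp add: gcoef_Suc)
next
  case (Suc k)
  then show ?case using assms
    by (subst gcoef_Suc) (intro mult_neg_pos divide_pos_pos, auto)
qed

section \<open>Signs of the weights \<open>omega\<close> and of their partial sums\<close>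

lemma lam_signs:
  assumes "1 < b" "b < 2"
  shows "0 \<le> lam1 b" "0 \<le> lam0 b" "lamm1 b \<le> 0"
proof -
  show "0 \<le> lam1 b" using assms by (simp add: lam1_def)
  show "0 \<le> lam0 b" using assms power_mono[of b 2 2] by (simp add: lam0_def)
  have "0 \<le> (b - 1) * (2 - b)" using assms by simp
  then show "lamm1 b \<le> 0" by (simp add: lamm1_def algebra_simps power2_eq_square)
qed

text \<open>The negative \<open>lamm1 b\<close> has to be outweighed. If \<open>r\<close> and
  \<open>s\<close> are ratios of consecutive coefficients, a three-term weight is a coefficient
  times this expression, which is nondecreasing in positive \<open>r\<close> and \<open>s\<close>.
  At the lower bounds, which are the ratios of \<open>gcoef b\<close> from index 2 to 3 and from 3
  to 4, 144 times it is the square of \<open>(2 - b) * (b + 5)\<close>.\<close>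

lemma lam_combination_nonneg:
  assumes b: "1 < b" "b < 2" and r: "(2 - b) / 3 \<le> r" and s: "(3 - b) / 4 \<le> s"
  shows "0 \<le> lam1 b * (r * s) + lam0 b * r + lamm1 b"
proof -
  have rs: "(2 - b) / 3 * ((3 - b) / 4) \<le> r * s"
    using b r s by (intro mult_mono) auto
  have "0 \<le> (2 - b) * ((2 - b) * (b\<^sup>2 + 10 * b + 25))"
    using b by (intro mult_nonneg_nonneg) auto
  also have "\<dots> = 144 * (lam1 b * ((2 - b) / 3 * ((3 - b) / 4)) + lam0 b * ((2 - b) / 3) + lamm1 b)"
    by (simp add: lam1_def lam0_def lamm1_def field_simps power2_eq_square)
  finally have "0 \<le> lam1 b * ((2 - b) / 3 * ((3 - b) / 4)) + lam0 b * ((2 - b) / 3) + lamm1 b"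
    by simp
  also have "\<dots> \<le> lam1 b * (r * s) + lam0 b * r + lamm1 b"
    using lam_signs[OF b] rs r by (intro add_mono mult_left_mono) auto
  finally show ?thesis .
qed

lemma omega_nonneg:
  assumes b: "1 < b" "b < 2" and k: "3 \<le> k"
  shows "0 \<le> omega b k"
proof -
  obtain n where n: "k = n + 3" using k by (metis add.commute le_Suc_ex)
  have om: "omega b k = lam1 b * gcoef b (n + 3) + lam0 b * gcoef b (n + 2) + lamm1 b * gcoef b (n + 1)"
    by (simp add: omega_def n numeral_eq_Suc)
  show ?thesis
  proof (cases n)
    \<comment> \<open>Here \<open>k = 3\<close>, and \<open>lamm1 b\<close> multiplies
      \<open>gcoef b 1 = - b\<close>, so no term is negative. For larger \<open>k\<close> its factor
      is positive and \<open>lam_combination_nonneg\<close> is needed.\<close>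
    case 0
    note lam_signs[OF b]
    moreover have "gcoef b 1 \<le> 0" using b by (simp add: gcoef_Suc)
    moreover have "gcoef b 2 \<ge> 0" "gcoef b 3 \<ge> 0"
      using gcoef_pos[OF b, of 0] gcoef_pos[OF b, of 1] by (auto simp: numeral_2_eq_2 numeral_3_eq_3)
    ultimately show ?thesis unfolding om 0 add_0
      by (intro add_nonneg_nonneg mult_nonneg_nonneg mult_nonpos_nonpos[of "lamm1 b"])
  next
    case (Suc m)
    define r where "r = (real m + 2 - b) / (real m + 3)"
    define s where "s = (real m + 3 - b) / (real m + 4)"
    have g1: "gcoef b (m + 3) = gcoef b (m + 2) * r"
      using gcoef_Suc[of b "m + 2"] by (simp add: r_def add_ac numeral_eq_Suc)
    have g2: "gcoef b (m + 4) = gcoef b (m + 3) * s"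
      using gcoef_Suc[of b "m + 3"] by (simp add: s_def add_ac numeral_eq_Suc)
    have "(2 - b) / 3 \<le> r" "(3 - b) / 4 \<le> s"
      using b by (auto simp: r_def s_def field_simps)
    then have "0 \<le> gcoef b (m + 2) * (lam1 b * (r * s) + lam0 b * r + lamm1 b)"
      using lam_combination_nonneg[OF b] gcoef_pos[OF b, of m] by simp
    also have "\<dots> = omega b k"
      unfolding om Suc using g1 g2 by (simp add: algebra_simps add_ac numeral_eq_Suc)
    finally show ?thesis .
  qed
qed

text \<open>\<open>omega b 2\<close> alone is negative for \<open>b\<close> near 1, but the
  quadratic form sees only this sum. The resulting quartic has the root 1, and the cofactor of
  \<open>b - 1\<close> is a sum of nonnegative terms.\<close>

lemma omega_0_2_nonneg:
  assumes b: "1 < b" "b < 2"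
  shows "0 \<le> omega b 0 + omega b 2"
proof -
  have "0 \<le> (b - 1) * ((b ^ 3 - 1) + 7 * (b\<^sup>2 - 1) + 10 * b)"
    using b by (intro mult_nonneg_nonneg add_nonneg_nonneg) auto
  also have "\<dots> = b^4 + 6 * b^3 + 3 * b\<^sup>2 - 18 * b + 8"
    by (simp add: algebra_simps power2_eq_square power3_eq_cube power4_eq_xxxx)
  also have "\<dots> = 24 * (omega b 0 + omega b 2)"
    by (simp add: omega_def lam1_def lam0_def lamm1_def gcoef_Suc numeral_2_eq_2 field_simps
        power2_eq_square power3_eq_cube power4_eq_xxxx)
  finally show ?thesis by simp
qed

lemma sum_omega:
  "(\<Sum>k\<le>n + 2. omega b k)
    = lam1 b * gcoef (b - 1) (n + 2) + lam0 b * gcoef (b - 1) (n + 1) + lamm1 b * gcoef (b - 1) n"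
proof -
  have "(\<Sum>k\<le>n + 2. omega b k)
    = lam1 b * (\<Sum>k\<le>n + 2. gcoef b k) + lam0 b * (\<Sum>k\<le>n + 1. gcoef b k) + lamm1 b * (\<Sum>k\<le>n. gcoef b k)"
  proof (induction n)
    case 0
    then show ?case by (simp add: omega_def numeral_2_eq_2 algebra_simps)
  next
    case (Suc n)
    then show ?case by (simp add: omega_def algebra_simps)
  qed
  then show ?thesis by (simp only: sum_gcoef)
qed

text \<open>By \<open>sum_omega\<close> the partial sums have the shape of \<open>omega\<close> in
  order \<open>b - 1\<close>. Those coefficients are negative from index 1 on, so the nonnegative
  combination now gives a nonpositive product. For \<open>N = 2\<close> the factor of
  \<open>lamm1 b\<close> is \<open>gcoef (b - 1) 0 = 1\<close>, and each term is
  nonpositive.\<close>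

lemma sum_omega_nonpos:
  assumes b: "1 < b" "b < 2" and N: "2 \<le> N"
  shows "(\<Sum>k\<le>N. omega b k) \<le> 0"
proof -
  obtain n where n: "N = n + 2" using N by (metis add.commute le_Suc_ex)
  have b': "0 < b - 1" "b - 1 < 1" using b by auto
  show ?thesis
  proof (cases n)
    case 0
    note lam_signs[OF b]
    moreover have "gcoef (b - 1) 1 \<le> 0" "gcoef (b - 1) 2 \<le> 0"
      using gcoef_neg[OF b', of 0] gcoef_neg[OF b', of 1] by (auto simp: numeral_2_eq_2)
    ultimately show ?thesis unfolding n sum_omega 0
      by (auto intro!: add_nonpos_nonpos mult_nonneg_nonpos simp: numeral_2_eq_2)
  next
    case (Suc m)
    define r where "r = (real m + 2 - b) / (real m + 2)"
    define s where "s = (real m + 3 - b) / (real m + 3)"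
    have g1: "gcoef (b - 1) (m + 2) = gcoef (b - 1) (m + 1) * r"
      using gcoef_Suc[of "b - 1" "m + 1"] by (simp add: r_def add_ac numeral_eq_Suc)
    have g2: "gcoef (b - 1) (m + 3) = gcoef (b - 1) (m + 2) * s"
      using gcoef_Suc[of "b - 1" "m + 2"] by (simp add: s_def add_ac numeral_eq_Suc)
    have "(2 - b) / 3 \<le> (2 - b) / 2" "(3 - b) / 4 \<le> (3 - b) / 3" 
      using b by auto
    moreover have "(2 - b) / 2 \<le> r" "(3 - b) / 3 \<le> s"
      using b by (auto simp: r_def s_def field_simps)
    ultimately have "0 \<le> lam1 b * (r * s) + lam0 b * r + lamm1 b"
      by (intro lam_combination_nonneg[OF b]) auto
    then have "gcoef (b - 1) (m + 1) * (lam1 b * (r * s) + lam0 b * r + lamm1 b) \<le> 0"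
      using gcoef_neg[OF b', of m] by (intro mult_nonpos_nonneg) auto
    also have "gcoef (b - 1) (m + 1) * (lam1 b * (r * s) + lam0 b * r + lamm1 b) = (\<Sum>k\<le>N. omega b k)"
      unfolding n sum_omega Suc using g1 g2 by (simp add: algebra_simps add_ac numeral_eq_Suc)
    finally show ?thesis .
  qed
qed

section \<open>Quadratic forms of the spatial operator\<close>

text \<open>Sorted by \<open>k\<close>, the form is the sum of \<open>omega b k * C k\<close> with
  \<open>C k\<close> the autocorrelation of \<open>v\<close> at lag \<open>k - 1\<close>. Lag 0
  gives \<open>Q\<close>, and lags -1 and 1 agree. After merging these two, only nonnegative weights
  multiply correlations at positive lags, and those are at most \<open>Q\<close>; what remains is
  \<open>Q\<close> times the sum of all weights.\<close>

lemma sum_left_nonpos: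
  assumes b: "1 < b" "b < 2" and N: "2 \<le> N" and v: "v 0 = 0" "v N = 0"
  shows "(\<Sum>i = 1..N - 1. v i * (\<Sum>k = 0..i + 1. omega b k * v (i + 1 - k))) \<le> 0"
proof -
  define I where "I k = {i \<in> {1..N - 1}. k \<le> i + 1}" for k
  define C where "C k = (\<Sum>i\<in>I k. v i * v (i + 1 - k))" for k
  define Q where "Q = (\<Sum>i = 1..N - 1. (v i)\<^sup>2)"
  have fin: "finite (I k)" for k by (simp add: I_def)
  have "(\<Sum>i = 1..N - 1. v i * (\<Sum>k = 0..i + 1. omega b k * v (i + 1 - k)))
      = (\<Sum>i = 1..N - 1. \<Sum>k\<in>{k \<in> {..N}. k \<le> i + 1}. omega b k * (v i * v (i + 1 - k)))"
  proof (rule sum.cong[OF refl])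
    fix i assume "i \<in> {1..N - 1}"
    then have "{k \<in> {..N}. k \<le> i + 1} = {0..i + 1}" by auto
    then show "v i * (\<Sum>k = 0..i + 1. omega b k * v (i + 1 - k))
      = (\<Sum>k\<in>{k \<in> {..N}. k \<le> i + 1}. omega b k * (v i * v (i + 1 - k)))"
      by (simp only: sum_distrib_left mult_ac)
  qed
  also have "\<dots> = (\<Sum>k\<le>N. \<Sum>i\<in>I k. omega b k * (v i * v (i + 1 - k)))"
    unfolding I_def by (rule sum.swap_restrict) auto
  also have "\<dots> = (\<Sum>k\<le>N. omega b k * C k)"
    by (simp add: C_def sum_distrib_left)
  also have "\<dots> = omega b 0 * C 0 + omega b 1 * C 1 + omega b 2 * C 2 + (\<Sum>k = 3..N. omega b k * C k)"
  proof -
    have "{..N} = {0, 1, 2} \<union> {3..N}" using N by auto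
    then show ?thesis by (subst \<open>{..N} = _\<close>, subst sum.union_disjoint) auto
  qed
  also have "C 1 = Q"
  proof -
    have "I 1 = {1..N - 1}" by (auto simp: I_def)
    then show ?thesis by (simp add: C_def Q_def power2_eq_square)
  qed
  \<comment> \<open>An index shift turns lag -1 into lag 1. The ranges differ only at 1 and
    \<open>N\<close>, where a boundary value enters the product.\<close>
  also have "C 0 = C 2"
  proof -
    have I: "I 0 = {1..N - 1}" "I 2 = {1..N - 1}" by (auto simp: I_def)
    then have "C 0 = (\<Sum>i\<in>{1..N - 1}. v i * v (i + 1))"
      by (simp add: C_def)
    also have "\<dots> = (\<Sum>i\<in>{2..N}. v i * v (i - 1))"
      by (rule sum.reindex_bij_witness[of _ "\<lambda>i. i - 1" "\<lambda>i. i + 1"]) auto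
    also have "\<dots> = (\<Sum>i\<in>{1..N - 1}. v i * v (i - 1))"
    proof (rule sum.mono_neutral_cong)
      fix i assume "i \<in> {2..N} - {1..N - 1}"
      then have "i = N" by auto
      then show "v i * v (i - 1) = 0" by (simp add: v)
    next
      fix i assume "i \<in> {1..N - 1} - {2..N}"
      then have "i = 1" by auto
      then show "v i * v (i - 1) = 0" by (simp add: v)
    qed auto
    also have "\<dots> = C 2"
      using I by (simp add: C_def numeral_2_eq_2)
    finally show ?thesis .
  qed
  finally have eq: "(\<Sum>i = 1..N - 1. v i * (\<Sum>k = 0..i + 1. omega b k * v (i + 1 - k)))
    = omega b 1 * Q + (omega b 0 + omega b 2) * C 2 + (\<Sum>k = 3..N. omega b k * C k)"
    by (simp add: algebra_simps)
  have CQ: "C k \<le> Q" if "2 \<le> k" for k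
  proof -
    have "(\<Sum>i\<in>I k. (v i)\<^sup>2) \<le> Q"
      unfolding Q_def I_def by (rule sum_mono2) auto
    moreover have "(\<Sum>i\<in>I k. (v (i + 1 - k))\<^sup>2) = (\<Sum>i\<in>(\<lambda>i. i + 1 - k) ` I k. (v i)\<^sup>2)"
      by (subst sum.reindex) (auto simp: I_def inj_on_def)
    moreover have "\<dots> \<le> (\<Sum>i\<in>{0..N - 1}. (v i)\<^sup>2)"
      using that by (intro sum_mono2) (auto simp: I_def)
    moreover have "\<dots> = Q"
      unfolding Q_def by (rule sum.mono_neutral_right) (auto simp: v not_le)
    moreover have "2 * C k \<le> (\<Sum>i\<in>I k. (v i)\<^sup>2) + (\<Sum>i\<in>I k. (v (i + 1 - k))\<^sup>2)"
      unfolding C_def sum_distrib_left sum.distrib[symmetric] 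
      by (rule sum_mono) (use sum_squares_bound in \<open>simp add: mult.assoc[symmetric]\<close>)
    ultimately show ?thesis by linarith
  qed
  have Q: "0 \<le> Q" by (simp add: Q_def sum_nonneg)
  have "omega b 1 * Q + (omega b 0 + omega b 2) * C 2 + (\<Sum>k = 3..N. omega b k * C k)
    \<le> omega b 1 * Q + (omega b 0 + omega b 2) * Q + (\<Sum>k = 3..N. omega b k * Q)"
    using omega_0_2_nonneg[OF b] omega_nonneg[OF b] CQ
    by (intro add_mono[OF add_mono[OF order_refl]] mult_left_mono sum_mono) auto
  also have "\<dots> = (\<Sum>k\<le>N. omega b k) * Q"
  proof -
    have "{..N} = {0, 1, 2} \<union> {3..N}" using N by auto
    then have "(\<Sum>k\<le>N. omega b k) = omega b 0 + omega b 1 + omega b 2 + (\<Sum>k = 3..N. omega b k)"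
      by (subst \<open>{..N} = _\<close>, subst sum.union_disjoint) auto
    then show ?thesis by (simp add: algebra_simps sum_distrib_left)
  qed
  also have "\<dots> \<le> 0"
    using sum_omega_nonpos[OF b N] Q by (rule mult_nonpos_nonneg)
  finally show ?thesis unfolding eq .
qed

lemma sum_right_nonpos:
  assumes b: "1 < b" "b < 2" and N: "2 \<le> N" and v: "v 0 = 0" "v N = 0"
  shows "(\<Sum>i = 1..N - 1. v i * (\<Sum>k = 0..N - i + 1. omega b k * v (i + k - 1))) \<le> 0"
proof -
  have "(\<Sum>i = 1..N - 1. v i * (\<Sum>k = 0..N - i + 1. omega b k * v (i + k - 1)))
    = (\<Sum>i = 1..N - 1. v (N - i) * (\<Sum>k = 0..i + 1. omega b k * v (N - (i + 1 - k))))"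
  proof (rule sum.reindex_bij_witness[of _ "\<lambda>i. N - i" "\<lambda>i. N - i"], goal_cases)
    case (5 i)
    then show ?case
      by (auto intro!: arg_cong2[of _ _ _ _ "(*)"] sum.cong arg_cong[of _ _ v])
  qed auto
  also have "\<dots> \<le> 0"
    using sum_left_nonpos[OF b N, of "\<lambda>i. v (N - i)"] v by simp
  finally show ?thesis .
qed

text \<open>The summand is the increment of \<open>v i * v (i + 1)\<close>, so the sum telescopes to
  products containing \<open>v 0\<close> or \<open>v N\<close>.\<close>

lemma sum_central_difference:
  fixes v :: "nat \<Rightarrow> real"
  assumes "1 \<le> N" "v 0 = 0" "v N = 0"
  shows "(\<Sum>i = 1..N - 1. v i * (v (i + 1) - v (i - 1))) = 0"
proof -
  obtain n where n: "N = Suc n" using assms by (cases N) auto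
  have "(\<Sum>i = 1..n. v i * (v (i + 1) - v (i - 1))) = v n * v (Suc n) - v 1 * v 0" for n
    by (induction n) (auto simp: algebra_simps)
  then show ?thesis using assms by (simp add: n)
qed

lemma delta_h_nonpos:
  assumes b: "1 < \<beta>" "\<beta> < 2" and N: "2 \<le> N" and v: "v 0 = 0" "v N = 0"
    and d: "0 \<le> dp ts" "0 \<le> dm ts"
  shows "(\<Sum>i = 1..N - 1. v i * delta_h \<gamma> dp dm \<beta> N h ts v i) \<le> 0"
proof -
  have "(\<Sum>i = 1..N - 1. v i * delta_h \<gamma> dp dm \<beta> N h ts v i)
    = \<gamma> ts / (2 * h) * (\<Sum>i = 1..N - 1. v i * (v (i + 1) - v (i - 1)))
     + dp ts / h powr \<beta> * (\<Sum>i = 1..N - 1. v i * (\<Sum>k = 0..i + 1. omega \<beta> k * v (i + 1 - k)))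
     + dm ts / h powr \<beta> * (\<Sum>i = 1..N - 1. v i * (\<Sum>k = 0..N - i + 1. omega \<beta> k * v (i + k - 1)))"
  proof -
    have "v i * delta_h \<gamma> dp dm \<beta> N h ts v i
      = \<gamma> ts / (2 * h) * (v i * (v (i + 1) - v (i - 1)))
      + dp ts / h powr \<beta> * (v i * (\<Sum>k = 0..i + 1. omega \<beta> k * v (i + 1 - k)))
      + dm ts / h powr \<beta> * (v i * (\<Sum>k = 0..N - i + 1. omega \<beta> k * v (i + k - 1)))" for i
      unfolding delta_h_def by (simp only: distrib_left mult.left_commute[of "v i"] times_divide_eq_left times_divide_eq_right)
    then show ?thesis by (simp only: sum.distrib sum_distrib_left[symmetric])
  qed
  also have "\<dots> \<le> 0"
  proof -
    have "(\<Sum>i = 1..N - 1. v i * (v (i + 1) - v (i - 1))) = 0"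
      using N v by (intro sum_central_difference) auto
    moreover have "0 \<le> dp ts / h powr \<beta>" "0 \<le> dm ts / h powr \<beta>" using d by auto
    note mult_nonneg_nonpos[OF this(1) sum_left_nonpos[where v = v, OF b N v]]
      mult_nonneg_nonpos[OF this(2) sum_right_nonpos[where v = v, OF b N v]]
    ultimately show ?thesis by (simp only: mult_zero_right)
  qed
  finally show ?thesis .
qed

section \<open>Time-stepping weights\<close>

lemma convex_integral_le_trapezoid:
  fixes f F :: "real \<Rightarrow> real"
  assumes f: "convex_on {x..x + 1} f"
    and F: "\<And>y. x \<le> y \<Longrightarrow> y \<le> x + 1 \<Longrightarrow> (F has_real_derivative f y) (at y)"
  shows "F (x + 1) - F x \<le> (f x + f (x + 1)) / 2"
proof -
  \<comment> \<open>The derivative of \<open>H\<close> is \<open>f\<close> minus its chord over the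
    interval, nonpositive by convexity; \<open>H 1 - H 0\<close> is the integral minus the
    trapezoidal value.\<close>
  define H where "H s = F (x + s) - s * f x - s\<^sup>2 / 2 * (f (x + 1) - f x)" for s
  have "H 1 \<le> H 0"
  proof (rule DERIV_nonpos_imp_nonincreasing[of 0 1 H])
    fix s :: real assume s: "0 \<le> s" "s \<le> 1"
    have "((\<lambda>s. F (x + s)) has_real_derivative f (x + s)) (at s)"
      using s by (intro DERIV_chain2[where g = "\<lambda>s. x + s" and Db = 1, OF F, simplified])
        (auto intro!: derivative_eq_intros)
    then have "(H has_real_derivative f (x + s) - f x - s * (f (x + 1) - f x)) (at s)"
      unfolding H_def by (auto intro!: derivative_eq_intros)
    moreover have "f (x + s) \<le> (1 - s) * f x + s * f (x + 1)"
      using convex_onD[OF f, of s x "x + 1"] s by (simp add: algebra_simps)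
    then have "f (x + s) - f x - s * (f (x + 1) - f x) \<le> 0"
      by (simp add: algebra_simps)
    ultimately show "\<exists>y. (H has_real_derivative y) (at s) \<and> y \<le> 0" by blast
  qed simp
  then show ?thesis by (simp add: H_def field_simps)
qed

lemma convex_on_powr_neg:
  assumes "a \<le> 0" "0 < x"
  shows "convex_on {x..y} (\<lambda>t::real. t powr a)"
proof (rule f''_ge0_imp_convex[where f' = "\<lambda>t. a * t powr (a - 1)" and f'' = "\<lambda>t. a * ((a - 1) * t powr (a - 2))"])
  fix t assume "t \<in> {x..y}"
  then show "((\<lambda>t. t powr a) has_real_derivative a * t powr (a - 1)) (at t)"
    "((\<lambda>t. a * t powr (a - 1)) has_real_derivative a * ((a - 1) * t powr (a - 2))) (at t)"
    using assms by (auto intro!: derivative_eq_intros)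
  show "0 \<le> a * ((a - 1) * t powr (a - 2))"
    using assms by (intro mult_nonpos_nonpos mult_nonpos_nonneg) auto
qed simp

lemma convex_on_minus_powr:
  assumes "0 \<le> a" "a \<le> 1" "0 < x"
  shows "convex_on {x..y} (\<lambda>t::real. - (t powr a))"
proof (rule f''_ge0_imp_convex[where f' = "\<lambda>t. - a * t powr (a - 1)" and f'' = "\<lambda>t. a * ((1 - a) * t powr (a - 2))"])
  fix t assume "t \<in> {x..y}"
  then show "((\<lambda>t. - (t powr a)) has_real_derivative - a * t powr (a - 1)) (at t)"
    "((\<lambda>t. - a * t powr (a - 1)) has_real_derivative a * ((1 - a) * t powr (a - 2))) (at t)"
    using assms by (auto intro!: derivative_eq_intros simp: algebra_simps)
  show "0 \<le> a * ((1 - a) * t powr (a - 2))"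
    using assms by auto
qed simp

lemma powr_diff_bounds:
  fixes x p :: real
  assumes x: "0 < x" and p: "0 < p" "p < 1"
  shows "p * (x + 1) powr (p - 1) \<le> (x + 1) powr p - x powr p"
    and "(x + 1) powr p - x powr p \<le> p * x powr (p - 1)"
proof -
  have "\<exists>z. z > x \<and> z < x + 1 \<and> (x + 1) powr p - x powr p = (x + 1 - x) * (p * z powr (p - 1))"
    using x by (intro MVT2) (auto intro!: derivative_eq_intros)
  then obtain z where z: "x < z" "z < x + 1" "(x + 1) powr p - x powr p = p * z powr (p - 1)"
    by auto
  have "(x + 1) powr (p - 1) \<le> z powr (p - 1)" "z powr (p - 1) \<le> x powr (p - 1)"
    using z x p by (auto intro!: powr_mono2')
  then show "p * (x + 1) powr (p - 1) \<le> (x + 1) powr p - x powr p"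
    "(x + 1) powr p - x powr p \<le> p * x powr (p - 1)"
    using z p by auto
qed

text \<open>The defect of the trapezoidal rule for \<open>t powr p\<close> on \<open>{x..x + 1}\<close>, so that
  \<open>bcoef \<alpha> l\<close> is its value at \<open>l - 1 + \<sigma>\<close> for \<open>p = 1 - \<alpha>\<close>.\<close>
definition trap_defect :: "real \<Rightarrow> real \<Rightarrow> real" where
  "trap_defect p x = 1 / (1 + p) * ((x + 1) powr (1 + p) - x powr (1 + p))
     - 1 / 2 * ((x + 1) powr p + x powr p)"

text \<open>The power is concave, so the trapezoidal rule underestimates its integral.\<close>

lemma trap_defect_nonneg:
  assumes x: "0 < x" and p: "0 < p" "p < 1"
  shows "0 \<le> trap_defect p x"
proof -
  have "- ((x + 1) powr (1 + p) / (1 + p)) - - (x powr (1 + p) / (1 + p))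
      \<le> (- (x powr p) + - ((x + 1) powr p)) / 2"
    by (rule convex_integral_le_trapezoid[OF convex_on_minus_powr, of p x "\<lambda>t. - (t powr (1 + p) / (1 + p))"])
       (use x p in \<open>auto intro!: derivative_eq_intros\<close>)
  then show ?thesis by (simp add: trap_defect_def right_diff_distrib add_divide_distrib)
qed

lemma has_real_derivative_trap_defect:
  assumes x: "0 < x" and p: "0 < p" "p < 1"
  shows "(trap_defect p has_real_derivative
    (x + 1) powr p - x powr p - p / 2 * ((x + 1) powr (p - 1) + x powr (p - 1))) (at x)"
proof -
  have "(trap_defect p has_real_derivative
    1 / (1 + p) * ((1 + p) * (x + 1) powr p - (1 + p) * x powr p)
      - 1 / 2 * (p * (x + 1) powr (p - 1) + p * x powr (p - 1))) (at x)"
    unfolding trap_defect_def using x p by (auto intro!: derivative_eq_intros)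
  then show ?thesis
    using p unfolding right_diff_distrib[symmetric, of "1 + p"] distrib_left[symmetric, of p] by simp
qed

text \<open>The derivative of the defect is the defect for the convex function
  \<open>p * t powr (p - 1)\<close>, whose integral the trapezoidal rule overestimates.\<close>

lemma trap_defect_antimono:
  assumes x: "0 < x" "x \<le> y" and p: "0 < p" "p < 1"
  shows "trap_defect p y \<le> trap_defect p x"
proof (rule DERIV_nonpos_imp_nonincreasing[OF x(2)])
  fix z assume "x \<le> z" "z \<le> y"
  then have z: "0 < z" using x by simp
  have "(z + 1) powr p / p - z powr p / p \<le> (z powr (p - 1) + (z + 1) powr (p - 1)) / 2"
    by (rule convex_integral_le_trapezoid[OF convex_on_powr_neg, of "p - 1" z "\<lambda>t. t powr p / p"])
       (use z p in \<open>auto intro!: derivative_eq_intros\<close>)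
  then have "(z + 1) powr p - z powr p - p / 2 * ((z + 1) powr (p - 1) + z powr (p - 1)) \<le> 0"
    using p by (simp add: field_simps)
  then show "\<exists>d. (trap_defect p has_real_derivative d) (at z) \<and> d \<le> 0"
    using has_real_derivative_trap_defect[OF z p] by blast
qed

text \<open>For \<open>p = 1 - \<alpha>\<close> and \<open>x = l - 1 + \<sigma>\<close> with
  \<open>l \<ge> 1\<close> this is \<open>acoef \<alpha> l - bcoef \<alpha> l\<close>: the last
  weight of step \<open>l\<close>, and an interior weight up to adding
  \<open>bcoef \<alpha> (l + 1)\<close>.\<close>

definition powr_inc :: "real \<Rightarrow> real \<Rightarrow> real" where
  "powr_inc p x = (x + 1) powr p - x powr p - trap_defect p x"

lemma powr_inc_antimono:
  assumes x: "0 < x" "x \<le> y" and p: "0 < p" "p < 1"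
  shows "powr_inc p y \<le> powr_inc p x"
proof (rule DERIV_nonpos_imp_nonincreasing[OF x(2)])
  fix z assume "x \<le> z" "z \<le> y"
  then have z: "0 < z" using x by simp
  let ?d = "p * (z + 1) powr (p - 1) - p * z powr (p - 1)
    - ((z + 1) powr p - z powr p - p / 2 * ((z + 1) powr (p - 1) + z powr (p - 1)))"
  have "(powr_inc p has_real_derivative ?d) (at z)"
    unfolding powr_inc_def using z has_real_derivative_trap_defect[OF z p]
    by (auto intro!: derivative_eq_intros)
  \<comment> \<open>The lower bound on the increment reduces \<open>?d\<close> to at most half of
    \<open>p * (z + 1) powr (p - 1) - p * z powr (p - 1)\<close>, and the two bounds together make
    this nonpositive.\<close>
  moreover have "?d \<le> 0"
    using powr_diff_bounds[OF z p] by (simp add: algebra_simps)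
  ultimately show "\<exists>d. (powr_inc p has_real_derivative d) (at z) \<and> d \<le> 0" by blast
qed

text \<open>The integral is at most the right endpoint value, so the defect is at most half the
  increment and \<open>powr_inc\<close> keeps the other half.\<close>

lemma powr_inc_ge:
  assumes x: "0 < x" and p: "0 < p" "p < 1"
  shows "p / 2 * (x + 1) powr (p - 1) \<le> powr_inc p x"
proof -
  have "\<exists>z. z > x \<and> z < x + 1 \<and>
    (x + 1) powr (1 + p) / (1 + p) - x powr (1 + p) / (1 + p) = (x + 1 - x) * z powr p"
    using x p by (intro MVT2) (auto intro!: derivative_eq_intros)
  then obtain z where z: "x < z" "z < x + 1"
    "(x + 1) powr (1 + p) / (1 + p) - x powr (1 + p) / (1 + p) = z powr p" by auto
  have "z powr p \<le> (x + 1) powr p" using z x p by (intro powr_mono2) auto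
  then have "trap_defect p x \<le> (x + 1) powr p - 1 / 2 * ((x + 1) powr p + x powr p)"
    using z(3) by (simp add: trap_defect_def right_diff_distrib)
  then show ?thesis
    using powr_diff_bounds(1)[OF x p] by (simp add: powr_inc_def field_simps)
qed

section \<open>Sign and monotonicity of the time-stepping weights\<close>

context
  fixes \<alpha> :: real
  assumes alpha: "0 < \<alpha>" "\<alpha> < 1"
begin

lemma bcoef_eq: "bcoef \<alpha> (Suc l) = trap_defect (1 - \<alpha>) (real l + sig \<alpha>)"
  by (simp add: bcoef_def trap_defect_def add_ac)

lemma acoef_minus_bcoef: "acoef \<alpha> (Suc l) - bcoef \<alpha> (Suc l) = powr_inc (1 - \<alpha>) (real l + sig \<alpha>)"
  by (simp add: acoef_def bcoef_eq powr_inc_def add_ac)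

lemma sig_bounds: "1 / 2 < sig \<alpha>" "sig \<alpha> < 1"
  using alpha by (auto simp: sig_def)

lemma bcoef_nonneg: "0 \<le> bcoef \<alpha> (Suc l)"
  unfolding bcoef_eq using alpha sig_bounds by (intro trap_defect_nonneg) auto

lemma bcoef_antimono: "bcoef \<alpha> (Suc (Suc l)) \<le> bcoef \<alpha> (Suc l)"
  unfolding bcoef_eq using alpha sig_bounds by (intro trap_defect_antimono) auto

lemma acoef_minus_bcoef_antimono:
  "acoef \<alpha> (Suc (Suc l)) - bcoef \<alpha> (Suc (Suc l)) \<le> acoef \<alpha> (Suc l) - bcoef \<alpha> (Suc l)"
  unfolding acoef_minus_bcoef using alpha sig_bounds by (intro powr_inc_antimono) auto

text \<open>The upper bound \<open>(1 - \<alpha>) * \<sigma> powr (- \<alpha>)\<close> for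
  \<open>acoef \<alpha> 1\<close> is \<open>(1 - \<alpha>) / \<sigma>\<close> times
  \<open>acoef \<alpha> 0\<close>, the \<open>bcoef\<close> corrections have helpful signs, and the
  choice of \<sigma> makes \<open>1 - \<alpha>\<close> equal to
  \<open>2 * \<sigma> - 1\<close>.\<close>

lemma ccoef_0_1:
  assumes "1 \<le> j"
  shows "(sig \<alpha>)\<^sup>2 * ccoef \<alpha> j 1 \<le> (2 * sig \<alpha> - 1) * ccoef \<alpha> j 0"
proof -
  have s: "0 < sig \<alpha>" "sig \<alpha> \<le> 1" using sig_bounds by auto
  have "ccoef \<alpha> j 1 \<le> acoef \<alpha> 1"
    using assms bcoef_antimono[of 0] bcoef_nonneg[of 0] by (auto simp: ccoef_def numeral_2_eq_2)
  also have "\<dots> \<le> (1 - \<alpha>) * sig \<alpha> powr (- \<alpha>)"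
    using powr_diff_bounds(2)[of "sig \<alpha>" "1 - \<alpha>"] s alpha by (simp add: acoef_def add.commute)
  finally have "(sig \<alpha>)\<^sup>2 * ccoef \<alpha> j 1 \<le> sig \<alpha> * (sig \<alpha> * ((1 - \<alpha>) * sig \<alpha> powr (- \<alpha>)))"
    using s by (simp add: power2_eq_square mult.assoc)
  also have "\<dots> \<le> 1 * (sig \<alpha> * ((1 - \<alpha>) * sig \<alpha> powr (- \<alpha>)))"
    using s alpha by (intro mult_right_mono) auto
  also have "\<dots> = (1 - \<alpha>) * acoef \<alpha> 0"
    using s by (simp add: acoef_def powr_diff powr_minus_divide)
  also have "\<dots> \<le> (1 - \<alpha>) * ccoef \<alpha> j 0"
    using assms alpha bcoef_nonneg[of 0] by (simp add: ccoef_def)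
  also have "1 - \<alpha> = 2 * sig \<alpha> - 1" by (simp add: sig_def)
  finally show ?thesis .
qed

text \<open>This rate of decay is what offsets the prefactor \<open>\<tau> powr (- \<alpha>)\<close>
  in the maximum principle.\<close>

lemma ccoef_last_ge: "(1 - \<alpha>) / 2 * (real j + 1) powr (- \<alpha>) \<le> ccoef \<alpha> j j"
proof (cases j)
  case 0
  have "(1 - \<alpha>) / 2 \<le> 1 / 2" using alpha by simp
  also have "\<dots> \<le> sig \<alpha> powr 1" using sig_bounds by simp
  also have "\<dots> \<le> sig \<alpha> powr (1 - \<alpha>)"
    using sig_bounds alpha by (intro powr_mono') auto
  finally show ?thesis by (simp add: 0 ccoef_def acoef_def)
next
  case (Suc l)
  have "(1 - \<alpha>) / 2 * (real j + 1) powr (- \<alpha>) \<le> (1 - \<alpha>) / 2 * (real l + sig \<alpha> + 1) powr (- \<alpha>)"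
    using sig_bounds alpha by (intro mult_left_mono powr_mono2') (auto simp: Suc)
  also have "\<dots> \<le> powr_inc (1 - \<alpha>) (real l + sig \<alpha>)"
    using powr_inc_ge[of "real l + sig \<alpha>" "1 - \<alpha>"] sig_bounds alpha by auto
  also have "\<dots> = ccoef \<alpha> j j"
    by (simp add: Suc ccoef_def acoef_minus_bcoef)
  finally show ?thesis .
qed

lemma ccoef_last_pos: "0 < ccoef \<alpha> j j"
proof -
  have "0 < (1 - \<alpha>) / 2 * (real j + 1) powr (- \<alpha>)" using alpha by simp
  then show ?thesis using ccoef_last_ge[of j] by linarith
qed

text \<open>An interior weight is \<open>acoef - bcoef\<close> at \<open>m\<close> plus
  \<open>bcoef\<close> at \<open>m + 1\<close>, both decreasing in \<open>m\<close>; the last weight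
  only lacks the nonnegative second part.\<close>

lemma ccoef_antimono_interior:
  assumes "1 \<le> m" "m < j"
  shows "ccoef \<alpha> j (Suc m) \<le> ccoef \<alpha> j m"
proof -
  obtain l where l: "m = Suc l" using assms by (cases m) auto
  show ?thesis
  proof (cases "Suc m < j")
    case True
    then show ?thesis
      using acoef_minus_bcoef_antimono[of l] bcoef_antimono[of "Suc l"] by (simp add: l ccoef_def)
  next
    case False
    then have "j = Suc m" using assms by simp
    then show ?thesis
      using acoef_minus_bcoef_antimono[of l] bcoef_nonneg[of "Suc l"] by (simp add: l ccoef_def)
  qed
qed


lemma ccoef_1_pos:
  assumes "1 \<le> j"
  shows "0 < ccoef \<alpha> j 1"
proof -
  have "0 < powr_inc (1 - \<alpha>) (sig \<alpha>)"
    using powr_inc_ge[of "sig \<alpha>" "1 - \<alpha>"] sig_bounds alpha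
    by (intro less_le_trans[OF _ powr_inc_ge]) auto
  also have "\<dots> = acoef \<alpha> 1 - bcoef \<alpha> 1"
    using acoef_minus_bcoef[of 0] by simp
  also have "\<dots> \<le> ccoef \<alpha> j 1"
    using assms bcoef_nonneg[of 1] by (auto simp: ccoef_def numeral_2_eq_2)
  finally show ?thesis .
qed

lemma ccoef_antimono:
  assumes "m < j"
  shows "ccoef \<alpha> j (Suc m) \<le> ccoef \<alpha> j m"
proof (cases "m = 0")
  case True
  \<comment> \<open>The first decrement follows from \<open>ccoef_0_1\<close>, because
    \<open>2 * \<sigma> - 1\<close> is at most the square of \<sigma>.\<close>
  have "0 \<le> (1 - sig \<alpha>)\<^sup>2" by simp
  then have "2 * sig \<alpha> - 1 \<le> (sig \<alpha>)\<^sup>2" by (simp add: power2_eq_square algebra_simps)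
  then have "(2 * sig \<alpha> - 1) * ccoef \<alpha> j 1 \<le> (sig \<alpha>)\<^sup>2 * ccoef \<alpha> j 1"
    using ccoef_1_pos[of j] assms by (intro mult_right_mono) auto
  also have "\<dots> \<le> (2 * sig \<alpha> - 1) * ccoef \<alpha> j 0"
    using ccoef_0_1[of j] assms by auto
  finally show ?thesis using sig_bounds True by simp
next
  case False
  then show ?thesis using assms by (intro ccoef_antimono_interior) auto
qed

lemma ccoef_pos:
  assumes "m \<le> j"
  shows "0 < ccoef \<alpha> j m"
  using assms
proof (induction rule: inc_induct)
  case base
  then show ?case by (rule ccoef_last_pos)
next
  case (step n)
  then show ?case using ccoef_antimono[of n j] by simp
qed

end

section \<open>Convolutions with decreasing weights\<close>

text \<open>Splitting off the newest increment leaves a convolution with the shifted weights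
  \<open>c (Suc m)\<close>; the inductions below therefore generalize over \<open>c\<close>.\<close>

lemma sum_convolution_Suc:
  fixes c :: "nat \<Rightarrow> real"
  shows "(\<Sum>s = 0..Suc j. c (Suc j - s) * d s) = (\<Sum>s = 0..j. c (Suc (j - s)) * d s) + c 0 * d (Suc j)"
  by (simp add: Suc_diff_le)

text \<open>Summation by parts: the terms dropped are decrements of \<open>c\<close> times values of
  \<open>z\<close>, all subtracted.\<close>

lemma convolution_diff_le:
  fixes c z :: "nat \<Rightarrow> real"
  assumes "\<And>m. m < j \<Longrightarrow> c (Suc m) \<le> c m" and "\<And>s. s \<le> j \<Longrightarrow> 0 \<le> z s"
  shows "(\<Sum>s = 0..j. c (j - s) * (z (s + 1) - z s)) \<le> c 0 * z (Suc j) - c j * z 0"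
  using assms
proof (induction j arbitrary: c)
  case 0
  then show ?case by (simp add: algebra_simps)
next
  case (Suc j)
  have "(\<Sum>s = 0..j. c (Suc (j - s)) * (z (s + 1) - z s)) \<le> c 1 * z (Suc j) - c (Suc j) * z 0"
    using Suc.IH[of "\<lambda>m. c (Suc m)"] Suc.prems by simp
  moreover have "c 1 * z (Suc j) \<le> c 0 * z (Suc j)"
    using Suc.prems by (intro mult_right_mono) auto
  ultimately show ?case
    unfolding sum_convolution_Suc[of c] by (simp add: right_diff_distrib)
qed

text \<open>Comparison with the constant \<open>K / \<eta>\<close>: the gap \<open>z\<close> is
  nonnegative at earlier levels by induction, and \<open>c i i * z 0 \<ge> K\<close> outweighs the
  source, which forces the newest gap to be nonnegative.\<close>

lemma convolution_max_principle:
  fixes c :: "nat \<Rightarrow> nat \<Rightarrow> real" and y :: "nat \<Rightarrow> real"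
  assumes c: "\<And>j m. m < j \<Longrightarrow> c j (Suc m) \<le> c j m"
    and eta: "0 < \<eta>" "\<And>j. j < M \<Longrightarrow> \<eta> \<le> c j j" "\<And>j. j < M \<Longrightarrow> 0 < c j 0"
    and y0: "y 0 = 0" and K: "0 \<le> K"
    and y: "\<And>j. j < M \<Longrightarrow> (\<Sum>s = 0..j. c j (j - s) * (y (s + 1) - y s)) \<le> K"
    and j: "j \<le> M"
  shows "y j \<le> K / \<eta>"
  using j
proof (induction j rule: less_induct)
  case (less j)
  show ?case
  proof (cases j)
    case 0
    then show ?thesis using y0 K eta by simp
  next
    case (Suc i)
    define z where "z s = K / \<eta> - y s" for s
    have i: "i < M" using less.prems Suc by simp
    have "- K \<le> - (\<Sum>s = 0..i. c i (i - s) * (y (s + 1) - y s))"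
      using y[OF i] by simp
    also have "\<dots> = (\<Sum>s = 0..i. c i (i - s) * (z (s + 1) - z s))"
      unfolding sum_negf[symmetric] by (simp add: z_def algebra_simps)
    also have "\<dots> \<le> c i 0 * z (Suc i) - c i i * z 0"
      using less Suc by (intro convolution_diff_le) (auto simp: z_def intro!: c)
    finally have "- K + c i i * (K / \<eta>) \<le> c i 0 * z (Suc i)" by (simp add: z_def y0)
    moreover have "\<eta> * (K / \<eta>) \<le> c i i * (K / \<eta>)"
      using eta i K by (intro mult_right_mono) auto
    ultimately have "0 \<le> c i 0 * z (Suc i)" using eta(1) by simp
    then have "0 \<le> z (Suc i)" using eta(3)[OF i] by (simp add: zero_le_mult_iff)
    then show ?thesis by (simp add: Suc z_def)
  qed
qed

text \<open>The fully implicit case \<sigma> = 1 with a quadratic surplus, which later pays for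
  \<sigma> < 1. In the step \<open>c 1 \<le> c 0\<close> weakens the surplus of the older part
  \<open>D\<close>; moving the reference value by \<open>d\<close> adds \<open>D * d\<close>, and
  the newest term completes the square.\<close>

lemma convolution_energy:
  fixes c y :: "nat \<Rightarrow> real"
  assumes "\<And>m. m < j \<Longrightarrow> c (Suc m) \<le> c m" and "\<And>m. m \<le> j \<Longrightarrow> 0 < c m"
  shows "(\<Sum>s = 0..j. c (j - s) * (y (s + 1) - y s))\<^sup>2 / (2 * c 0)
    \<le> (\<Sum>s = 0..j. c (j - s) * ((y (s + 1) - y s) * (y (Suc j) - (y (s + 1) + y s) / 2)))"
  using assms
proof (induction j arbitrary: c)
  case 0
  then show ?case by (simp add: power2_eq_square field_simps)
next
  case (Suc j)
  define D where "D = (\<Sum>s = 0..j. c (Suc (j - s)) * (y (s + 1) - y s))"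
  define d where "d = y (Suc (Suc j)) - y (Suc j)"
  have c: "0 < c 0" "0 < c 1" "c 1 \<le> c 0" using Suc.prems by auto
  have IH: "D\<^sup>2 / (2 * c 1)
    \<le> (\<Sum>s = 0..j. c (Suc (j - s)) * ((y (s + 1) - y s) * (y (Suc j) - (y (s + 1) + y s) / 2)))"
    (is "_ \<le> ?P")
    using Suc.IH[of "\<lambda>m. c (Suc m)"] Suc.prems by (simp add: D_def)
  have "D\<^sup>2 / (2 * c 0) \<le> D\<^sup>2 / (2 * c 1)"
    using c by (intro divide_left_mono) auto
  then have le: "D\<^sup>2 / (2 * c 0) \<le> ?P" using IH by linarith
  have square: "(D + c 0 * d)\<^sup>2 / (2 * c 0) = D\<^sup>2 / (2 * c 0) + D * d + c 0 * d\<^sup>2 / 2"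
    using c by (simp add: power2_eq_square field_simps)
  have left: "(\<Sum>s = 0..Suc j. c (Suc j - s) * (y (s + 1) - y s)) = D + c 0 * d"
    unfolding sum_convolution_Suc[of c] D_def d_def by simp
  have right: "(\<Sum>s = 0..Suc j. c (Suc j - s) * ((y (s + 1) - y s) * (y (Suc (Suc j)) - (y (s + 1) + y s) / 2)))
    = ?P + D * d + c 0 * d\<^sup>2 / 2"
    unfolding sum_convolution_Suc[of c] D_def d_def sum_distrib_right sum.distrib[symmetric]
    by (intro arg_cong2[of _ _ _ _ "(+)"] sum.cong) (auto simp: field_simps power2_eq_square)
  show ?case
    unfolding left right square using le by linarith
qed

text \<open>In the inductive step the difference of the two sides dominates the quadratic form
  \<open>D\<^sup>2 / (2 * c 1) + \<sigma> * D * d + (\<sigma> - 1 / 2) * c 0 * d\<^sup>2\<close> in the older part \<open>D\<close> of the convolution and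
  the newest increment \<open>d\<close>; the condition on \<open>\<sigma>\<close> says that its discriminant is nonpositive.\<close>

lemma convolution_sigma_energy:
  fixes c y :: "nat \<Rightarrow> real"
  assumes c: "\<And>m. m < j \<Longrightarrow> c (Suc m) \<le> c m" "\<And>m. m \<le> j \<Longrightarrow> 0 < c m"
    and \<sigma>: "1 / 2 \<le> \<sigma>" "1 \<le> j \<Longrightarrow> \<sigma>\<^sup>2 * c 1 \<le> (2 * \<sigma> - 1) * c 0"
  shows "(\<Sum>s = 0..j. c (j - s) * ((y (s + 1))\<^sup>2 - (y s)\<^sup>2))
    \<le> 2 * ((\<sigma> * y (Suc j) + (1 - \<sigma>) * y j) * (\<Sum>s = 0..j. c (j - s) * (y (s + 1) - y s)))"
proof -
  define d where "d = y (Suc j) - y j"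
  define S where "S = (\<Sum>s = 0..j. c (j - s) * (y (s + 1) - y s))"
  define P where "P = (\<Sum>s = 0..j. c (j - s) * ((y (s + 1) - y s) * (y (Suc j) - (y (s + 1) + y s) / 2)))"
  have "(\<Sum>s = 0..j. c (j - s) * ((y (s + 1))\<^sup>2 - (y s)\<^sup>2)) = 2 * (y (Suc j) * S - P)"
    unfolding S_def P_def sum_distrib_left sum_subtractf[symmetric]
    by (rule sum.cong) (auto simp: field_simps power2_eq_square)
  \<comment> \<open>The \<sigma>-average is \<open>y (Suc j) - (1 - \<sigma>) * d\<close>, so by the
    identity above this is the claim.\<close>
  moreover have "0 \<le> P - (1 - \<sigma>) * d * S"
  proof (cases j)
    case 0
    have "P - (1 - \<sigma>) * d * S = (\<sigma> - 1 / 2) * c 0 * d\<^sup>2"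
      by (simp add: 0 P_def S_def d_def field_simps power2_eq_square)
    then show ?thesis using \<sigma> c by (simp add: less_imp_le)
  next
    case (Suc i)
    define D where "D = (\<Sum>s = 0..i. c (Suc (i - s)) * (y (s + 1) - y s))"
    have c01: "0 < c 1" "0 < c 0" using c Suc by auto
    have S: "S = D + c 0 * d" unfolding S_def D_def d_def Suc sum_convolution_Suc[of c] by simp
    have "D\<^sup>2 / (2 * c 1)
      \<le> (\<Sum>s = 0..i. c (Suc (i - s)) * ((y (s + 1) - y s) * (y (Suc i) - (y (s + 1) + y s) / 2)))"
      (is "_ \<le> ?P")
      using convolution_energy[of i "\<lambda>m. c (Suc m)" y] c Suc by (simp add: D_def)
    moreover have "P = ?P + D * d + c 0 * d\<^sup>2 / 2"
      unfolding P_def Suc sum_convolution_Suc[of c] D_def d_def sum_distrib_right sum.distrib[symmetric]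
      by (intro arg_cong2[of _ _ _ _ "(+)"] sum.cong) (auto simp: field_simps power2_eq_square)
    ultimately have "D\<^sup>2 / (2 * c 1) + \<sigma> * D * d + (\<sigma> - 1 / 2) * c 0 * d\<^sup>2 \<le> P - (1 - \<sigma>) * d * S"
      by (simp add: S algebra_simps power2_eq_square)
    moreover have "0 \<le> D\<^sup>2 / (2 * c 1) + \<sigma> * D * d + (\<sigma> - 1 / 2) * c 0 * d\<^sup>2"
    proof -
      have "0 \<le> (D + \<sigma> * c 1 * d)\<^sup>2 / (2 * c 1)" using c01 by simp
      also have "\<dots> = D\<^sup>2 / (2 * c 1) + \<sigma> * D * d + \<sigma>\<^sup>2 * c 1 * d\<^sup>2 / 2"
        using c01 by (simp add: power2_eq_square field_simps)
      also have "\<sigma>\<^sup>2 * c 1 * d\<^sup>2 / 2 \<le> (2 * \<sigma> - 1) * c 0 * d\<^sup>2 / 2"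
        using \<sigma>(2) Suc by (intro divide_right_mono mult_right_mono) auto
      also have "(2 * \<sigma> - 1) * c 0 * d\<^sup>2 / 2 = (\<sigma> - 1 / 2) * c 0 * d\<^sup>2" by (simp add: field_simps)
      finally show ?thesis by simp
    qed
    ultimately show ?thesis by linarith
  qed
  ultimately show ?thesis
    unfolding S_def[symmetric] by (simp add: d_def algebra_simps)
qed

section \<open>Stability and convergence\<close>

lemma disc_caputo_diff:
  "disc_caputo \<alpha> \<tau> j (\<lambda>s. v s - w s) = disc_caputo \<alpha> \<tau> j v - disc_caputo \<alpha> \<tau> j w"
  unfolding disc_caputo_def right_diff_distrib[symmetric] sum_subtractf[symmetric]
  by (simp add: algebra_simps)

lemma delta_h_diff:
  "delta_h \<gamma> dp dm \<beta> N h ts (\<lambda>k. v k - w k) i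
    = delta_h \<gamma> dp dm \<beta> N h ts v i - delta_h \<gamma> dp dm \<beta> N h ts w i"
  unfolding delta_h_def right_diff_distrib sum_subtractf by (simp add: diff_divide_distrib)

lemma disc_caputo_sigma_energy:
  assumes alpha: "0 < \<alpha>" "\<alpha> < 1" and \<tau>: "0 < \<tau>"
  shows "disc_caputo \<alpha> \<tau> j (\<lambda>s. (w s)\<^sup>2)
    \<le> 2 * ((sig \<alpha> * w (j + 1) + (1 - sig \<alpha>) * w j) * disc_caputo \<alpha> \<tau> j w)"
proof -
  let ?A = "\<tau> powr (- \<alpha>) / Gamma (2 - \<alpha>)"
  have "(\<Sum>s = 0..j. ccoef \<alpha> j (j - s) * ((w (s + 1))\<^sup>2 - (w s)\<^sup>2))
    \<le> 2 * ((sig \<alpha> * w (Suc j) + (1 - sig \<alpha>) * w j) * (\<Sum>s = 0..j. ccoef \<alpha> j (j - s) * (w (s + 1) - w s)))"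
    using ccoef_antimono[OF alpha] ccoef_pos[OF alpha] sig_bounds[OF alpha] ccoef_0_1[OF alpha]
    by (intro convolution_sigma_energy) auto
  moreover have "0 \<le> ?A" using alpha by simp
  ultimately have "?A * (\<Sum>s = 0..j. ccoef \<alpha> j (j - s) * ((w (s + 1))\<^sup>2 - (w s)\<^sup>2))
    \<le> ?A * (2 * ((sig \<alpha> * w (Suc j) + (1 - sig \<alpha>) * w j) * (\<Sum>s = 0..j. ccoef \<alpha> j (j - s) * (w (s + 1) - w s))))"
    by (rule mult_left_mono)
  then show ?thesis
    unfolding disc_caputo_def by (simp only: mult.left_commute[of ?A] Suc_eq_plus1)
qed

text \<open>The reciprocal of the prefactor of \<open>disc_caputo\<close> times the smallest lower
  bound on the last weights; with \<open>\<tau> = T / M\<close> the powers of \<open>M\<close>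
  cancel.\<close>

definition stability_const :: "real \<Rightarrow> real \<Rightarrow> real" where
  "stability_const \<alpha> T = Gamma (2 - \<alpha>) * T powr \<alpha> * (2 / (1 - \<alpha>))"

lemma stability_const_pos: "0 < \<alpha> \<Longrightarrow> \<alpha> < 1 \<Longrightarrow> 0 < T \<Longrightarrow> 0 < stability_const \<alpha> T"
  by (simp add: stability_const_def)

lemma disc_caputo_max_principle:
  assumes alpha: "0 < \<alpha>" "\<alpha> < 1" and T: "0 < T" and M: "1 \<le> M"
    and y0: "y 0 = 0" and K: "0 \<le> K"
    and y: "\<And>j. j < M \<Longrightarrow> disc_caputo \<alpha> (T / real M) j y \<le> K"
    and j: "j \<le> M"
  shows "y j \<le> stability_const \<alpha> T * K"
proof -
  define A where "A = (T / real M) powr (- \<alpha>) / Gamma (2 - \<alpha>)"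
  \<comment> \<open>The bound of \<open>ccoef_last_ge\<close> at the final step
    \<open>M - 1\<close>, valid for all earlier steps.\<close>
  define \<eta> where "\<eta> = (1 - \<alpha>) / 2 * real M powr (- \<alpha>)"
  have A: "0 < A" using alpha T M by (simp add: A_def)
  have \<eta>: "0 < \<eta>" using alpha M by (simp add: \<eta>_def)
  have "y j \<le> K / A / \<eta>"
  proof (rule convolution_max_principle[where c = "ccoef \<alpha>" and M = M])
    show "\<eta> \<le> ccoef \<alpha> i i" if "i < M" for i
    proof -
      have "\<eta> \<le> (1 - \<alpha>) / 2 * (real i + 1) powr (- \<alpha>)"
        unfolding \<eta>_def using alpha that by (intro mult_left_mono powr_mono2') auto
      then show ?thesis using ccoef_last_ge[OF alpha, of i] by linarith
    qed
    show "(\<Sum>s = 0..i. ccoef \<alpha> i (i - s) * (y (s + 1) - y s)) \<le> K / A" if "i < M" for i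
      using y[OF that] A by (simp add: disc_caputo_def A_def[symmetric] field_simps)
  qed (use ccoef_antimono[OF alpha] ccoef_pos[OF alpha] \<eta> A y0 K j in auto)
  also have "\<dots> = K * (1 / (A * \<eta>))" by simp
  also have "1 / (A * \<eta>) = stability_const \<alpha> T"
  proof -
    have "(T / real M) powr (- \<alpha>) * real M powr (- \<alpha>) = T powr (- \<alpha>)"
      using T M by (simp add: powr_mult[symmetric])
    then have "A * \<eta> = T powr (- \<alpha>) / Gamma (2 - \<alpha>) * ((1 - \<alpha>) / 2)"
      by (simp add: A_def \<eta>_def)
    then show ?thesis by (simp add: stability_const_def powr_minus_divide)
  qed
  finally show ?thesis by (simp add: mult.commute)
qed

lemma disc_caputo_sum: "disc_caputo \<alpha> \<tau> j (\<lambda>s. \<Sum>i\<in>I. w s i) = (\<Sum>i\<in>I. disc_caputo \<alpha> \<tau> j (\<lambda>s. w s i))"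
proof -
  have "(\<Sum>s = 0..j. ccoef \<alpha> j (j - s) * ((\<Sum>i\<in>I. w (s + 1) i) - (\<Sum>i\<in>I. w s i)))
    = (\<Sum>i\<in>I. \<Sum>s = 0..j. ccoef \<alpha> j (j - s) * (w (s + 1) i - w s i))"
    unfolding sum_subtractf[symmetric] sum_distrib_left by (rule sum.swap)
  then show ?thesis by (simp add: disc_caputo_def sum_distrib_left)
qed

text \<open>Absorbing the maximum over all time levels takes the place of a discrete Gronwall
  inequality. The sum is unweighted, hence the factor \<open>N\<close>, which \<open>h\<close> later
  turns into \<open>b - a\<close>.\<close>

lemma scheme_stability:
  assumes alpha: "0 < \<alpha>" "\<alpha> < 1" and beta: "1 < \<beta>" "\<beta> < 2" and T: "0 < T"
    and dpos: "\<And>t. 0 \<le> t \<Longrightarrow> t \<le> T \<Longrightarrow> 0 \<le> dp t \<and> 0 \<le> dm t"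
    and N: "2 \<le> N" and M: "1 \<le> M"
    and init: "\<And>i. 1 \<le> i \<Longrightarrow> i \<le> N - 1 \<Longrightarrow> E 0 i = 0"
    and bdry: "\<And>j. j \<le> M \<Longrightarrow> E j 0 = 0 \<and> E j N = 0"
    and eq: "\<And>i j. 1 \<le> i \<Longrightarrow> i \<le> N - 1 \<Longrightarrow> j < M \<Longrightarrow>
      disc_caputo \<alpha> (T / real M) j (\<lambda>s. E s i)
      = delta_h \<gamma> dp dm \<beta> N h ((real j + sig \<alpha>) * (T / real M))
          (\<lambda>k. sig \<alpha> * E (j + 1) k + (1 - sig \<alpha>) * E j k) i + R j i"
    and R: "\<And>i j. 1 \<le> i \<Longrightarrow> i \<le> N - 1 \<Longrightarrow> j < M \<Longrightarrow> \<bar>R j i\<bar> \<le> \<rho>"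
    and j: "j \<le> M"
  shows "(\<Sum>i = 1..N - 1. (E j i)\<^sup>2) \<le> real N * (2 * stability_const \<alpha> T * \<rho>)\<^sup>2"
proof -
  define \<kappa> where "\<kappa> = stability_const \<alpha> T"
  \<comment> \<open>Chosen so that \<open>\<kappa> * \<epsilon> * Y\<close> is \<open>Y / 2\<close>,
    which can be moved to the left side.\<close>
  define \<epsilon> where "\<epsilon> = 1 / (2 * \<kappa>)"
  define y where "y s = (\<Sum>i = 1..N - 1. (E s i)\<^sup>2)" for s
  define Y where "Y = Max (y ` {..M})"
  have \<kappa>: "0 < \<kappa>" unfolding \<kappa>_def using alpha T by (rule stability_const_pos)
  then have \<epsilon>: "0 < \<epsilon>" by (simp add: \<epsilon>_def)
  have \<sigma>: "0 < sig \<alpha>" "sig \<alpha> < 1" using sig_bounds[OF alpha] by auto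
  have yY: "y s \<le> Y" if "s \<le> M" for s
    unfolding Y_def using that by (intro Max_ge) auto
  have Y0: "0 \<le> Y"
    using yY[of 0] by (intro order_trans[OF _ yY[of 0]]) (auto simp: y_def sum_nonneg)
  define K where "K = \<epsilon> * Y + real N * (\<rho>\<^sup>2 / \<epsilon>)"
  have K: "0 \<le> K" using \<epsilon> Y0 by (simp add: K_def)
  have bound: "disc_caputo \<alpha> (T / real M) n y \<le> K" if n: "n < M" for n
  proof -
    define V where "V k = sig \<alpha> * E (n + 1) k + (1 - sig \<alpha>) * E n k" for k
    define ts where "ts = (real n + sig \<alpha>) * (T / real M)"
    have "(real n + sig \<alpha>) * (T / real M) \<le> real M * (T / real M)"
      using n \<sigma> T by (intro mult_right_mono) auto
    then have ts: "0 \<le> ts" "ts \<le> T"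
      using n \<sigma> T M by (auto simp: ts_def)
    have "disc_caputo \<alpha> (T / real M) n y = (\<Sum>i = 1..N - 1. disc_caputo \<alpha> (T / real M) n (\<lambda>s. (E s i)\<^sup>2))"
      unfolding y_def by (rule disc_caputo_sum)
    also have "\<dots> \<le> (\<Sum>i = 1..N - 1. 2 * (V i * disc_caputo \<alpha> (T / real M) n (\<lambda>s. E s i)))"
      unfolding V_def using alpha T M by (intro sum_mono disc_caputo_sigma_energy) auto
    also have "\<dots> = (\<Sum>i = 1..N - 1. 2 * (V i * delta_h \<gamma> dp dm \<beta> N h ts V i) + 2 * (V i * R n i))"
    proof (rule sum.cong[OF refl])
      fix i assume "i \<in> {1..N - 1}"
      then have "disc_caputo \<alpha> (T / real M) n (\<lambda>s. E s i) = delta_h \<gamma> dp dm \<beta> N h ts V i + R n i"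
        using eq[of i n] n by (simp add: V_def[abs_def] ts_def)
      then show "2 * (V i * disc_caputo \<alpha> (T / real M) n (\<lambda>s. E s i))
        = 2 * (V i * delta_h \<gamma> dp dm \<beta> N h ts V i) + 2 * (V i * R n i)"
        by (simp add: algebra_simps)
    qed
    also have "\<dots> = 2 * (\<Sum>i = 1..N - 1. V i * delta_h \<gamma> dp dm \<beta> N h ts V i) + (\<Sum>i = 1..N - 1. 2 * (V i * R n i))"
      by (simp only: sum.distrib sum_distrib_left)
    also have "\<dots> \<le> (\<Sum>i = 1..N - 1. 2 * (V i * R n i))"
    proof -
      have "(\<Sum>i = 1..N - 1. V i * delta_h \<gamma> dp dm \<beta> N h ts V i) \<le> 0"
        using bdry[of n] bdry[of "n + 1"] n dpos[OF ts]
        by (intro delta_h_nonpos beta N) (auto simp: V_def)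
      then show ?thesis by linarith
    qed
    also have "\<dots> \<le> (\<Sum>i = 1..N - 1. \<epsilon> * (sig \<alpha> * (E (n + 1) i)\<^sup>2 + (1 - sig \<alpha>) * (E n i)\<^sup>2) + \<rho>\<^sup>2 / \<epsilon>)"
    proof (rule sum_mono)
      fix i assume i: "i \<in> {1..N - 1}"
      \<comment> \<open>Young's inequality; below, convexity of the square splits \<open>V i\<close>
        into the two time levels.\<close>
      have "0 \<le> (\<epsilon> * V i - R n i)\<^sup>2 / \<epsilon>" using \<epsilon> by simp
      also have "\<dots> = \<epsilon> * (V i)\<^sup>2 + (R n i)\<^sup>2 / \<epsilon> - 2 * (V i * R n i)"
        using \<epsilon> by (simp add: power2_eq_square field_simps)
      finally have "2 * (V i * R n i) \<le> \<epsilon> * (V i)\<^sup>2 + (R n i)\<^sup>2 / \<epsilon>" by simp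
      moreover have "\<bar>R n i\<bar> \<le> \<bar>\<rho>\<bar>"
        using R[of i n] i n by force
      then have "(R n i)\<^sup>2 / \<epsilon> \<le> \<rho>\<^sup>2 / \<epsilon>"
        using \<epsilon> by (intro divide_right_mono) (auto simp: abs_le_square_iff)
      moreover have "(V i)\<^sup>2 \<le> sig \<alpha> * (E (n + 1) i)\<^sup>2 + (1 - sig \<alpha>) * (E n i)\<^sup>2"
      proof -
        have "0 \<le> sig \<alpha> * (1 - sig \<alpha>) * (E (n + 1) i - E n i)\<^sup>2"
          using \<sigma> by simp
        also have "\<dots> = sig \<alpha> * (E (n + 1) i)\<^sup>2 + (1 - sig \<alpha>) * (E n i)\<^sup>2 - (V i)\<^sup>2"
          by (simp add: V_def power2_eq_square algebra_simps)
        finally show ?thesis by simp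
      qed
      then have "\<epsilon> * (V i)\<^sup>2 \<le> \<epsilon> * (sig \<alpha> * (E (n + 1) i)\<^sup>2 + (1 - sig \<alpha>) * (E n i)\<^sup>2)"
        using \<epsilon> by simp
      ultimately show "2 * (V i * R n i)
        \<le> \<epsilon> * (sig \<alpha> * (E (n + 1) i)\<^sup>2 + (1 - sig \<alpha>) * (E n i)\<^sup>2) + \<rho>\<^sup>2 / \<epsilon>"
        by linarith
    qed
    also have "\<dots> = \<epsilon> * (sig \<alpha> * y (n + 1) + (1 - sig \<alpha>) * y n) + real (N - 1) * (\<rho>\<^sup>2 / \<epsilon>)"
      by (simp only: sum.distrib sum_distrib_left[symmetric] y_def sum_constant card_atLeastAtMost) simp
    also have "\<dots> \<le> \<epsilon> * (sig \<alpha> * Y + (1 - sig \<alpha>) * Y) + real N * (\<rho>\<^sup>2 / \<epsilon>)"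
      using yY[of n] yY[of "n + 1"] \<sigma> \<epsilon> n
      by (intro add_mono mult_left_mono mult_right_mono) auto
    also have "\<dots> = K" by (simp add: K_def algebra_simps)
    finally show ?thesis .
  qed
  have y_le: "y s \<le> \<kappa> * K" if "s \<le> M" for s
    unfolding \<kappa>_def using init bound that
    by (intro disc_caputo_max_principle[OF alpha T M _ K]) (simp_all add: y_def[of 0])
  have "Y \<in> y ` {..M}" unfolding Y_def by (rule Max_in) auto
  then have "Y \<le> \<kappa> * K" using y_le by auto
  also have "\<dots> = Y / 2 + real N * (2 * \<kappa>\<^sup>2 * \<rho>\<^sup>2)"
    using \<kappa> by (simp add: K_def \<epsilon>_def field_simps power2_eq_square)
  finally have "Y \<le> real N * (2 * \<kappa> * \<rho>)\<^sup>2"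
    by (simp add: power_mult_distrib)
  then show ?thesis
    using yY[OF j] by (simp add: y_def \<kappa>_def)
qed

section \<open>Convergence, with the truncation error as source of the error equation\<close>

theorem theorem3:
  fixes \<alpha> \<beta> a b T d_star :: real
    and \<gamma> dp dm \<phi> :: "real \<Rightarrow> real"
    and f u :: "real \<Rightarrow> real \<Rightarrow> real"
  assumes alpha: "0 < \<alpha>" "\<alpha> < 1"
    and beta: "1 < \<beta>" "\<beta> < 2"
    and ab: "a < b" and T: "0 < T"
    and dpos: "\<And>t. 0 \<le> t \<Longrightarrow> t \<le> T \<Longrightarrow> 0 \<le> dp t \<and> 0 \<le> dm t"
    and dstar: "0 < d_star" "\<And>t. 0 \<le> t \<Longrightarrow> t \<le> T \<Longrightarrow> dp t + dm t \<ge> d_star"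
    and pde: "\<And>x t. a < x \<Longrightarrow> x < b \<Longrightarrow> 0 < t \<Longrightarrow> t \<le> T \<Longrightarrow>
               caputo_t \<alpha> u x t = \<gamma> t * deriv (\<lambda>y. u y t) x + dp t * rl_left \<beta> a u x t
                 + dm t * rl_right \<beta> b u x t + f x t"
    and init: "\<And>x. a \<le> x \<Longrightarrow> x \<le> b \<Longrightarrow> u x 0 = \<phi> x"
    and bdry: "\<And>t. 0 \<le> t \<Longrightarrow> t \<le> T \<Longrightarrow> u a t = 0 \<and> u b t = 0"
    and trunc: "\<exists>C_R. \<forall>N M i j. 5 \<le> N \<longrightarrow> 1 \<le> M \<longrightarrow> 1 \<le> i \<longrightarrow> i \<le> N - 1 \<longrightarrow> j < M \<longrightarrow>
               \<bar>trunc_err \<alpha> \<beta> a b T \<gamma> dp dm f u N M i j\<bar>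
                 \<le> C_R * ((T / real M)^2 + ((b - a) / real N)^2)"
  shows "\<exists>c > 0. \<forall>N M U. 5 \<le> N \<longrightarrow> 1 \<le> M \<longrightarrow> is_scheme_solution \<alpha> \<beta> a b T \<gamma> dp dm f \<phi> N M U \<longrightarrow>
           (\<forall>j \<le> M. grid_norm N ((b - a) / real N)
                      (\<lambda>i. u (a + real i * ((b - a) / real N)) (real j * (T / real M)) - U j i)
                    \<le> c * ((T / real M)^2 + ((b - a) / real N)^2))"
proof -
  obtain C where C: "\<And>N M i j. 5 \<le> N \<Longrightarrow> 1 \<le> M \<Longrightarrow> 1 \<le> i \<Longrightarrow> i \<le> N - 1 \<Longrightarrow> j < M \<Longrightarrow>
      \<bar>trunc_err \<alpha> \<beta> a b T \<gamma> dp dm f u N M i j\<bar> \<le> C * ((T / real M)^2 + ((b - a) / real N)^2)"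
    using trunc by blast
  define \<kappa> where "\<kappa> = stability_const \<alpha> T"
  have \<kappa>: "0 < \<kappa>" unfolding \<kappa>_def using alpha T by (rule stability_const_pos)
  \<comment> \<open>The root comes from \<open>h * N = b - a\<close>, the absolute value covers a
    negative \<open>C\<close>, and adding 1 keeps \<open>c\<close> positive if
    \<open>C = 0\<close>.\<close>
  define c where "c = sqrt (b - a) * (2 * \<kappa> * \<bar>C\<bar>) + 1"
  have c: "0 < c" using \<kappa> ab by (auto simp: c_def intro!: add_nonneg_pos)
  show ?thesis
  proof (intro exI[of _ c] conjI allI impI c)
    fix N M U j
    assume N: "5 \<le> N" and M: "1 \<le> M" and j: "j \<le> M"
      and sol: "is_scheme_solution \<alpha> \<beta> a b T \<gamma> dp dm f \<phi> N M U"
    define h where "h = (b - a) / real N"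
    define \<tau> where "\<tau> = T / real M"
    define e where "e = \<tau>\<^sup>2 + h\<^sup>2"
    define E where "E s i = u (a + real i * h) (real s * \<tau>) - U s i" for s i
    have e: "0 \<le> e" by (simp add: e_def)
    have h: "0 < h" "h * real N = b - a" using ab N by (auto simp: h_def)
    have \<tau>: "0 < \<tau>" "\<tau> * real M = T" using T M by (auto simp: \<tau>_def)
    have sol': "U 0 i = \<phi> (a + real i * h)" if "1 \<le> i" "i \<le> N - 1" for i
      using sol that by (auto simp: is_scheme_solution_def Let_def h_def)
    have sol_bdry: "U s 0 = 0" "U s N = 0" if "s \<le> M" for s
      using sol that by (auto simp: is_scheme_solution_def Let_def)
    have sol_eq: "disc_caputo \<alpha> \<tau> s (\<lambda>s. U s i)
        = delta_h \<gamma> dp dm \<beta> N h ((real s + sig \<alpha>) * \<tau>)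
            (\<lambda>k. sig \<alpha> * U (s + 1) k + (1 - sig \<alpha>) * U s k) i
          + f (a + real i * h) ((real s + sig \<alpha>) * \<tau>)" if "1 \<le> i" "i \<le> N - 1" "s < M" for i s
      using sol that unfolding is_scheme_solution_def Let_def h_def \<tau>_def by blast
    have "(\<Sum>i = 1..N - 1. (E j i)\<^sup>2) \<le> real N * (2 * stability_const \<alpha> T * (\<bar>C\<bar> * e))\<^sup>2"
    proof (rule scheme_stability[OF alpha beta T, where E = E and h = h
          and R = "\<lambda>s i. trunc_err \<alpha> \<beta> a b T \<gamma> dp dm f u N M i s"])
      fix i assume i: "1 \<le> i" "i \<le> N - 1"
      have "real i * h \<le> real N * h" using i h by (intro mult_right_mono) auto
      then have "a + real i * h \<le> b" using h by (simp add: mult.commute)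
      then show "E 0 i = 0"
        using i h init[of "a + real i * h"] sol' by (simp add: E_def)
    next
      fix s assume s: "s \<le> M"
      have "real s * \<tau> \<le> real M * \<tau>" using s \<tau> by (intro mult_right_mono) auto
      then have "real s * \<tau> \<le> T" using \<tau> by (simp add: mult.commute)
      moreover have "a + real N * h = b" using h by (simp add: mult.commute)
      ultimately show "E s 0 = 0 \<and> E s N = 0"
        using bdry[of "real s * \<tau>"] sol_bdry[OF s] \<tau> by (simp add: E_def)
    next
      fix i s assume i: "1 \<le> i" "i \<le> N - 1" and s: "s < M"
      let ?ts = "(real s + sig \<alpha>) * \<tau>"
      have "(\<lambda>k. sig \<alpha> * E (s + 1) k + (1 - sig \<alpha>) * E s k)
        = (\<lambda>k. (sig \<alpha> * u (a + real k * h) (real (s + 1) * \<tau>) + (1 - sig \<alpha>) * u (a + real k * h) (real s * \<tau>))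
            - (sig \<alpha> * U (s + 1) k + (1 - sig \<alpha>) * U s k))"
        by (simp add: E_def fun_eq_iff right_diff_distrib)
      \<comment> \<open>Subtracting the scheme from the definition of the truncation error cancels
        \<open>f\<close>; linearity of both discrete operators does the rest.\<close>
      then show "disc_caputo \<alpha> (T / real M) s (\<lambda>s. E s i)
        = delta_h \<gamma> dp dm \<beta> N h ((real s + sig \<alpha>) * (T / real M))
            (\<lambda>k. sig \<alpha> * E (s + 1) k + (1 - sig \<alpha>) * E s k) i
          + trunc_err \<alpha> \<beta> a b T \<gamma> dp dm f u N M i s"
        using sol_eq[OF i s]
        by (simp only: \<tau>_def[symmetric] h_def[symmetric] delta_h_diff disc_caputo_diff E_def trunc_err_def Let_def)
    next
      fix i s assume "1 \<le> i" "i \<le> N - 1" "s < M"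
      then have "\<bar>trunc_err \<alpha> \<beta> a b T \<gamma> dp dm f u N M i s\<bar> \<le> C * e"
        using C N M by (simp add: e_def h_def \<tau>_def)
      also have "\<dots> \<le> \<bar>C\<bar> * e" using e by (intro mult_right_mono) auto
      finally show "\<bar>trunc_err \<alpha> \<beta> a b T \<gamma> dp dm f u N M i s\<bar> \<le> \<bar>C\<bar> * e" .
    qed (use dpos N M j in simp_all)
    then have "h * (\<Sum>i = 1..N - 1. (E j i)\<^sup>2) \<le> h * (real N * (2 * \<kappa> * (\<bar>C\<bar> * e))\<^sup>2)"
      using h by (intro mult_left_mono) (auto simp: \<kappa>_def)
    also have "\<dots> = (b - a) * (2 * \<kappa> * (\<bar>C\<bar> * e))\<^sup>2"
      using h(2) by (simp only: mult.assoc[symmetric])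
    finally have "grid_norm N h (E j) \<le> sqrt ((b - a) * (2 * \<kappa> * (\<bar>C\<bar> * e))\<^sup>2)"
      by (simp add: grid_norm_def)
    also have "\<dots> = sqrt (b - a) * (2 * \<kappa> * \<bar>C\<bar>) * e"
      using \<kappa> e by (simp add: real_sqrt_mult abs_mult)
    also have "\<dots> \<le> c * e"
      using e by (simp add: c_def distrib_right)
    finally show "grid_norm N ((b - a) / real N)
        (\<lambda>i. u (a + real i * ((b - a) / real N)) (real j * (T / real M)) - U j i)
      \<le> c * ((T / real M)^2 + ((b - a) / real N)^2)"
      by (simp add: E_def[abs_def] e_def h_def \<tau>_def)
  qed
qed

end
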